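(* For every constant $0\le p<1$, the expected number $R_n(p)$ of occupied seats when the process ends, in a row of $n$ seats with a single entrance filled by $p$-courteous theatregoers choosing seats according to the right-biased Zipf distribution (model described in the context), satisfies $$R_n(p)=\Omega\!\left(\frac{H_n^2}{1-0.944p}\right)\quad\text{and}\quad R_n(p)=O\!\left(\frac{H_n^2}{1-p}\right)$$ as $n\to\infty$, where $H_n=\sum_{i=1}^n\frac1i$.
   Context: Row model: a row of $n$ seats with a single entrance at one end. Theatregoers arrive one at a time; each is, independently, courteous with probability $p$ and selfish with probability $1-p$, and this status never changes. A seated selfish theatregoer never gets up, so no later theatregoer can walk past her seat; a seated courteous theatregoer never blocks. An empty seat is accessible if it can be reached from the entrance without passing a seat occupied by a selfish theatregoer. When there are $m\ge1$ accessible empty seats, labelled $1,\dots,m$ in increasing order of distance from the entrance, the arriving theatregoer sits in the $k$-th one with probability $\frac{1}{(m+1-k)H_m}$ (right-biased Zipf distribution). The process ends when no accessible empty seat remains. *)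

theory Defs
  imports "HOL-Probability.Probability" "HOL-Analysis.Harmonic_Numbers"
    "HOL-Library.Landau_Symbols"
begin

text \<open>Seats are numbered \<open>1..n\<close>, seat 1 being the one next to the entrance. A
  configuration maps an occupied seat to the status of its occupant and an empty seat to \<open>None\<close>.\<close>

datatype status = Courteous | Selfish

type_synonym config = "nat \<Rightarrow> status option"

definition accessible :: "nat \<Rightarrow> config \<Rightarrow> nat set" where
  "accessible n s = {i \<in> {1..n}. s i = None \<and> (\<forall>j \<in> {1..<i}. s j \<noteq> Some Selfish)}"

text \<open>The right-biased Zipf distribution is meaningful for \<open>m \<ge> 1\<close>; see \<open>pmf_right_zipf\<close> below.\<close>

definition right_zipf :: "nat \<Rightarrow> nat pmf" where
  "right_zipf m =
     embed_pmf (\<lambda>k. if k \<in> {1..m} then 1 / (real (m + 1 - k) * harm m) else 0)"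

definition status_pmf :: "real \<Rightarrow> status pmf" where
  "status_pmf p = map_pmf (\<lambda>c. if c then Courteous else Selfish) (bernoulli_pmf p)"

text \<open>One arrival. The status of a theatregoer is drawn when she arrives, independently of
  everything else. Configurations without accessible empty seats are absorbing.\<close>

definition arrival :: "nat \<Rightarrow> real \<Rightarrow> config \<Rightarrow> config pmf" where
  "arrival n p s =
     (if accessible n s = {} then return_pmf s
      else do {
        k \<leftarrow> right_zipf (card (accessible n s));
        c \<leftarrow> status_pmf p;
        return_pmf (s(sorted_list_of_set (accessible n s) ! (k - 1) \<mapsto> c))
      })"

primrec after_arrivals :: "nat \<Rightarrow> real \<Rightarrow> nat \<Rightarrow> config pmf" where
  "after_arrivals n p 0 = return_pmf Map.empty"
| "after_arrivals n p (Suc t) = bind_pmf (after_arrivals n p t) (arrival n p)"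

text \<open>Every non-trivial arrival fills a seat, so the process has ended after at most \<open>n\<close>
  arrivals; see \<open>final_config_no_accessible\<close> below.\<close>

definition final_config :: "nat \<Rightarrow> real \<Rightarrow> config pmf" where
  "final_config n p = after_arrivals n p n"

definition expected_occupied :: "nat \<Rightarrow> real \<Rightarrow> real" where
  "expected_occupied n p = measure_pmf.expectation (final_config n p) (\<lambda>s. real (card (dom s)))"

lemma pmf_right_zipf:
  assumes "m \<ge> 1"
  shows "pmf (right_zipf m) k = (if k \<in> {1..m} then 1 / (real (m + 1 - k) * harm m) else 0)"
proof -
  let ?f = "\<lambda>k. if k \<in> {1..m} then 1 / (real (m + 1 - k) * harm m) else 0 :: real"
  have pos: "harm m > (0::real)" using assms by (simp add: harm_pos)
  have nn: "?f k \<ge> 0" for k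
    using harm_nonneg[of m] by (auto simp del: of_nat_diff intro!: divide_nonneg_nonneg mult_nonneg_nonneg)
  have "(\<Sum>k=1..m. 1 / (real (m + 1 - k) * harm m)) = (\<Sum>k=1..m. 1 / (real k * harm m))"
    by (rule sum.reindex_bij_witness[of _ "\<lambda>k. m + 1 - k" "\<lambda>k. m + 1 - k"]) auto
  also have "\<dots> = (\<Sum>k=1..m. inverse (real k)) / harm m"
    by (simp add: sum_divide_distrib field_simps)
  also have "\<dots> = 1" using pos by (simp add: harm_def)
  finally have s: "(\<Sum>k=1..m. ?f k) = 1" by simp
  have "(\<integral>\<^sup>+k. ennreal (?f k) \<partial>count_space UNIV) = (\<Sum>k\<in>{1..m}. ennreal (?f k))"
    by (rule nn_integral_count_space'[of "{1..m}"]) auto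
  also have "\<dots> = ennreal (\<Sum>k=1..m. ?f k)" by (rule sum_ennreal) (rule nn)
  finally have "(\<integral>\<^sup>+k. ennreal (?f k) \<partial>count_space UNIV) = 1" using s by simp
  then show ?thesis unfolding right_zipf_def by (rule pmf_embed_pmf[OF nn])
qed

lemma after_arrivals_progress:
  assumes "s \<in> set_pmf (after_arrivals n p t)"
  shows "dom s \<subseteq> {1..n} \<and> (accessible n s = {} \<or> card (dom s) = t)"
  using assms
proof (induction t arbitrary: s)
  case 0
  then show ?case by simp
next
  case (Suc t)
  then obtain s' where s': "s' \<in> set_pmf (after_arrivals n p t)"
    and st: "s \<in> set_pmf (arrival n p s')" by auto
  note IH = Suc.IH[OF s']
  show ?case
  proof (cases "accessible n s' = {}")
    case True
    then show ?thesis using st IH by (simp add: arrival_def)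
  next
    case False
    let ?A = "accessible n s'"
    have fin: "finite ?A" by (simp add: accessible_def)
    then have m: "card ?A \<ge> 1" using False by (simp add: Suc_le_eq card_gt_0_iff)
    obtain k c where k: "k \<in> set_pmf (right_zipf (card ?A))"
      and s: "s = s'(sorted_list_of_set ?A ! (k - 1) \<mapsto> c)"
      using st False by (auto simp: arrival_def)
    have "k \<in> {1..card ?A}"
      using k pmf_right_zipf[OF m, of k] by (auto simp: set_pmf_eq split: if_splits)
    then have "k - 1 < length (sorted_list_of_set ?A)" by auto
    then have "sorted_list_of_set ?A ! (k - 1) \<in> set (sorted_list_of_set ?A)"
      by (rule nth_mem)
    then have "sorted_list_of_set ?A ! (k - 1) \<in> ?A" by (simp only: set_sorted_list_of_set[OF fin])
    then obtain a where a_def: "a = sorted_list_of_set ?A ! (k - 1)" and "a \<in> ?A" by blast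
    have an: "a \<in> {1..n} \<and> s' a = None"
      using \<open>a \<in> ?A\<close> unfolding accessible_def mem_Collect_eq by (elim conjE) (intro conjI)
    then have a: "a \<in> {1..n}" "a \<notin> dom s'" by (simp_all add: domIff)
    have "dom s = insert a (dom s')" unfolding s a_def[symmetric] by simp
    moreover have "finite (dom s')" using IH finite_subset by blast
    ultimately show ?thesis using a IH False by simp
  qed
qed

lemma final_config_no_accessible:
  assumes "s \<in> set_pmf (final_config n p)"
  shows "accessible n s = {}"
proof (rule ccontr)
  assume ne: "accessible n s \<noteq> {}"
  with assms after_arrivals_progress have "dom s \<subseteq> {1..n}" "card (dom s) = n"
    unfolding final_config_def by blast+
  then have "dom s = {1..n}" by (simp add: card_subset_eq)
  moreover obtain i where "i \<in> {1..n}" "s i = None" using ne by (auto simp: accessible_def)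
  ultimately show False by (metis domIff)
qed

end

theory Submission
  imports Defs
begin

text \<open>Only the number of accessible seats matters: from \<open>m + 1\<close> of them, a courteous arrival leaves
  \<open>m\<close> and a selfish one, in the \<open>k\<close>-th of them, leaves \<open>k - 1\<close>. The expected number \<open>row_value p n\<close>
  of arrivals is therefore the function that vanishes at \<open>0\<close> and drops by 1 in expectation at each
  arrival, and a maximum principle compares it with multiples of \<open>(harm n)\<^sup>2\<close>.

  The expected drop of \<open>(harm n)\<^sup>2\<close> rests on the identity that the sum of
  \<open>(harm n - harm j) / (n - j)\<close> over \<open>j < n\<close> equals the sum of \<open>1 / i\<^sup>2\<close> over \<open>1 \<le> i \<le> n\<close>.
  A selfish arrival thus lowers \<open>(harm n)\<^sup>2\<close> on average by between 1 and \<open>pi\<^sup>2 / 3\<close>, whereas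
  a courteous arrival lowers it by an amount that is positive but tends to 0. This gives the order
  \<open>(harm n)\<^sup>2 / (1 - p)\<close> on both sides, which is stronger than the stated lower bound.\<close>

subsection \<open>Zipf means and expected drops\<close>

definition zipf_mean :: "nat \<Rightarrow> (nat \<Rightarrow> real) \<Rightarrow> real" where
  "zipf_mean n f = (\<Sum>j<n. f j / real (n - j)) / harm n"

lemma zipf_mean_cong [fundef_cong]:
  assumes "n = n'" "\<And>j. j < n' \<Longrightarrow> f j = g j"
  shows "zipf_mean n f = zipf_mean n' g"
  using assms by (simp add: zipf_mean_def)

lemma zipf_mean_mono:
  assumes "\<And>j. j < n \<Longrightarrow> f j \<le> g j"
  shows "zipf_mean n f \<le> zipf_mean n g"
  unfolding zipf_mean_def
  by (intro divide_right_mono sum_mono harm_nonneg) (use assms in auto)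

lemma zipf_mean_const:
  assumes "n > 0"
  shows "zipf_mean n (\<lambda>_. b) = b"
proof -
  have "(\<Sum>j<n. b / real (n - j)) = b * (\<Sum>j<n. inverse (real (Suc (n - Suc j))))"
    unfolding sum_distrib_left
    by (intro sum.cong refl) (simp add: Suc_diff_Suc divide_inverse del: of_nat_diff of_nat_Suc)
  also have "\<dots> = b * harm n"
    unfolding harm_altdef by (subst sum.nat_diff_reindex) (rule refl)
  finally have "(\<Sum>j<n. b / real (n - j)) = b * harm n" .
  moreover have "harm n \<noteq> (0 :: real)"
    using harm_pos[OF assms, where 'a = real] by linarith
  ultimately show ?thesis
    by (simp add: zipf_mean_def del: of_nat_diff)
qed

lemma zipf_mean_affine:
  assumes "n > 0"
  shows "zipf_mean n (\<lambda>j. a * f j + b) = a * zipf_mean n f + b"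
proof -
  have "zipf_mean n (\<lambda>j. a * f j + b) = a * zipf_mean n f + zipf_mean n (\<lambda>_. b)"
    by (simp add: zipf_mean_def add_divide_distrib sum.distrib sum_distrib_left del: of_nat_diff)
  then show ?thesis
    using assms by (simp add: zipf_mean_const)
qed

definition expected_drop :: "real \<Rightarrow> (nat \<Rightarrow> real) \<Rightarrow> nat \<Rightarrow> real" where
  "expected_drop p f m =
    p * (f (Suc m) - f m) + (1 - p) * (f (Suc m) - zipf_mean (Suc m) f)"

lemma expected_drop_affine: "expected_drop p (\<lambda>j. a * f j + b) m = a * expected_drop p f m"
  by (simp add: expected_drop_def zipf_mean_affine) (simp add: algebra_simps)

lemma expected_drop_maximum_principle:
  assumes p: "0 \<le> p" "p \<le> 1"
    and initial: "\<And>n. n \<le> M \<Longrightarrow> f n \<le> g n"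
    and drop: "\<And>m. M \<le> m \<Longrightarrow> expected_drop p f m \<le> expected_drop p g m"
  shows "f n \<le> g n"
proof (induction n rule: less_induct)
  case (less n)
  show ?case
  proof (cases "n \<le> M")
    case True
    then show ?thesis by (rule initial)
  next
    case False
    then obtain m where m: "n = Suc m" "M \<le> m" by (cases n) auto
    have "p * f m \<le> p * g m"
      using less.IH[of m] m p by (intro mult_left_mono) auto
    moreover have "zipf_mean (Suc m) f \<le> zipf_mean (Suc m) g"
      using less.IH m by (intro zipf_mean_mono) simp
    then have "(1 - p) * zipf_mean (Suc m) f \<le> (1 - p) * zipf_mean (Suc m) g"
      using p by (intro mult_left_mono) auto
    ultimately show ?thesis
      using drop[OF m(2)] unfolding expected_drop_def m(1) by (simp add: algebra_simps)
  qed
qed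

fun row_value :: "real \<Rightarrow> nat \<Rightarrow> real" where
  "row_value p 0 = 0"
| "row_value p (Suc m) =
    1 + p * row_value p m + (1 - p) * zipf_mean (Suc m) (\<lambda>j. row_value p j)"

lemma expected_drop_row_value: "expected_drop p (row_value p) m = 1"
  by (simp add: expected_drop_def algebra_simps)

lemma row_value_nonneg:
  assumes "0 \<le> p" "p \<le> 1"
  shows "0 \<le> row_value p n"
proof (rule expected_drop_maximum_principle[OF assms, where f = "\<lambda>_. 0" and M = 0])
  show "expected_drop p (\<lambda>_. 0) m \<le> expected_drop p (row_value p) m" for m
    unfolding expected_drop_row_value by (simp add: expected_drop_def zipf_mean_const)
qed simp

subsection \<open>Harmonic numbers\<close>

lemma harm_diff_quotient_Suc:
  assumes "j < n"
  shows "(harm (Suc n) - harm (Suc j)) / of_nat (n - j) =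
    (harm n - harm j) / of_nat (n - j) -
      inverse (of_nat (Suc j)) / (of_nat (Suc n) :: 'a :: real_normed_field)"
proof -
  define x y d where xyd: "x = (of_nat (Suc j) :: 'a)" "y = (of_nat (Suc n) :: 'a)"
    "d = (of_nat (n - j) :: 'a)"
  have "x \<noteq> 0" "y \<noteq> 0" and d: "d \<noteq> 0" and "y = x + d"
    using assms by (simp_all add: xyd del: of_nat_Suc of_nat_diff flip: of_nat_add)
  then have "inverse y - inverse x = - d * (inverse x / y)"
    by (simp add: field_simps)
  then have "harm (Suc n) - harm (Suc j) = (harm n - harm j) - d * (inverse x / y)"
    by (simp add: harm_Suc xyd algebra_simps del: of_nat_Suc of_nat_diff)
  then show ?thesis
    using d by (simp add: diff_divide_distrib xyd del: of_nat_Suc of_nat_diff)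
qed

lemma sum_harm_diff_quotients:
  "(\<Sum>j<n. (harm n - harm j) / of_nat (n - j)) =
    (\<Sum>i=1..n. 1 / (of_nat i)\<^sup>2 :: 'a :: real_normed_field)"
proof (induction n)
  case 0
  then show ?case by simp
next
  case (Suc n)
  let ?H = "harm :: nat \<Rightarrow> 'a"
  have "(\<Sum>j<Suc n. (?H (Suc n) - ?H j) / of_nat (Suc n - j)) =
      ?H (Suc n) / of_nat (Suc n) + (\<Sum>j<n. (?H (Suc n) - ?H (Suc j)) / of_nat (n - j))"
    unfolding sum.lessThan_Suc_shift by (simp add: harm_expand)
  also have "(\<Sum>j<n. (?H (Suc n) - ?H (Suc j)) / of_nat (n - j)) =
      (\<Sum>j<n. (?H n - ?H j) / of_nat (n - j)) - ?H n / of_nat (Suc n)"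
    by (simp add: harm_diff_quotient_Suc sum_subtractf del: of_nat_Suc of_nat_diff
        flip: sum_divide_distrib harm_altdef)
  also have "?H (Suc n) / of_nat (Suc n) = ?H n / of_nat (Suc n) + 1 / (of_nat (Suc n))\<^sup>2"
    by (simp add: harm_Suc power2_eq_square divide_inverse distrib_right del: of_nat_Suc)
  finally show ?case
    using Suc.IH by simp
qed

lemma sum_inverse_squares_le: "(\<Sum>i=1..n. 1 / (real i)\<^sup>2) \<le> pi\<^sup>2 / 6"
proof -
  have "(\<Sum>i=1..n. 1 / (real i)\<^sup>2) = (\<Sum>i<n. 1 / (real (i + 1))\<^sup>2)"
    by (rule sum.reindex_bij_witness[of _ Suc "\<lambda>i. i - 1"]) auto
  also have "\<dots> \<le> pi\<^sup>2 / 6"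
    using sum_le_suminf[OF sums_summable[OF inverse_squares_sums], of "{..<n}"]
      sums_unique[OF inverse_squares_sums] by simp
  finally show ?thesis .
qed

lemma sum_inverse_squares_ge_1:
  assumes "n > 0"
  shows "1 \<le> (\<Sum>i=1..n. 1 / (real i)\<^sup>2)"
  using member_le_sum[of 1 "{1..n}" "\<lambda>i. 1 / (real i)\<^sup>2"] assms by simp

lemma harm_square_minus_zipf_mean:
  assumes "n > 0"
  shows "(harm n)\<^sup>2 - zipf_mean n (\<lambda>j. (harm j)\<^sup>2) =
    (\<Sum>j<n. (harm n - harm j) / real (n - j) * (1 + harm j / harm n))"
proof -
  let ?H = "harm :: nat \<Rightarrow> real"
  have "(?H n)\<^sup>2 - zipf_mean n (\<lambda>j. (?H j)\<^sup>2) = zipf_mean n (\<lambda>j. (- 1) * (?H j)\<^sup>2 + (?H n)\<^sup>2)"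
    by (simp only: zipf_mean_affine[OF assms])
  also have "\<dots> = (\<Sum>j<n. ((?H n)\<^sup>2 - (?H j)\<^sup>2) / real (n - j) / ?H n)"
    by (simp add: zipf_mean_def sum_divide_distrib del: of_nat_diff)
  also have "\<dots> = (\<Sum>j<n. (?H n - ?H j) / real (n - j) * (1 + ?H j / ?H n))"
  proof (intro sum.cong refl)
    fix j
    have "1 + ?H j / ?H n = (?H n + ?H j) / ?H n"
      using assms by (simp add: add_divide_distrib harm_pos less_imp_neq[symmetric])
    then show "((?H n)\<^sup>2 - (?H j)\<^sup>2) / real (n - j) / ?H n =
        (?H n - ?H j) / real (n - j) * (1 + ?H j / ?H n)"
      by (simp add: power2_eq_square square_diff_square_factored mult.commute del: of_nat_diff)
  qed
  finally show ?thesis .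
qed

lemma harm_square_minus_zipf_mean_bounds:
  assumes n: "n > 0"
  shows "1 \<le> (harm n)\<^sup>2 - zipf_mean n (\<lambda>j. (harm j)\<^sup>2)"
    and "(harm n)\<^sup>2 - zipf_mean n (\<lambda>j. (harm j)\<^sup>2) \<le> pi\<^sup>2 / 3"
proof -
  define q r where "q j = (harm n - harm j) / real (n - j)"
    and "r j = harm j / (harm n :: real)" for j
  have sum_quotients: "sum q {..<n} = (\<Sum>i=1..n. 1 / (real i)\<^sup>2)"
    unfolding q_def by (rule sum_harm_diff_quotients)
  have harm_le: "harm j \<le> (harm n :: real)" if "j < n" for j
    using that by (intro harm_mono) simp
  have q_nonneg: "0 \<le> q j" if "j < n" for j
    unfolding q_def using harm_le[OF that] by (intro divide_nonneg_nonneg) auto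
  have r_bounds: "0 \<le> r j" "r j \<le> 1" if "j < n" for j
    unfolding r_def using harm_le[OF that] n by (auto simp: divide_le_eq harm_pos harm_nonneg)
  have weighted_sum: "(harm n)\<^sup>2 - zipf_mean n (\<lambda>j. (harm j)\<^sup>2) = (\<Sum>j<n. q j * (1 + r j))"
    unfolding q_def r_def by (rule harm_square_minus_zipf_mean[OF n])
  have "sum q {..<n} \<le> (\<Sum>j<n. q j * (1 + r j))"
    by (intro sum_mono) (use q_nonneg r_bounds in \<open>simp add: distrib_left\<close>)
  then show "1 \<le> (harm n)\<^sup>2 - zipf_mean n (\<lambda>j. (harm j)\<^sup>2)"
    unfolding weighted_sum using sum_quotients sum_inverse_squares_ge_1[OF n] by linarith
  have "(\<Sum>j<n. q j * (1 + r j)) \<le> (\<Sum>j<n. q j * 2)"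
    by (intro sum_mono mult_left_mono) (use q_nonneg r_bounds in auto)
  then show "(harm n)\<^sup>2 - zipf_mean n (\<lambda>j. (harm j)\<^sup>2) \<le> pi\<^sup>2 / 3"
    unfolding weighted_sum using sum_quotients sum_inverse_squares_le[of n]
    by (simp flip: sum_distrib_right)
qed

lemma harm_over_n_tendsto_0: "(\<lambda>n. harm n / real n :: real) \<longlonglongrightarrow> 0"
proof -
  have "(\<lambda>n. (harm n - ln (real n)) * (1 / real n) + ln (real n) / real n)
      \<longlonglongrightarrow> euler_mascheroni * 0 + 0"
    by (intro tendsto_intros euler_mascheroni_LIMSEQ lim_1_over_n lim_ln_over_n)
  then show ?thesis by (simp add: diff_divide_distrib)
qed

lemma harm_square_increment_tendsto_0: "(\<lambda>n. (harm (Suc n))\<^sup>2 - (harm n)\<^sup>2 :: real) \<longlonglongrightarrow> 0"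
proof -
  have "(harm (Suc n))\<^sup>2 - (harm n)\<^sup>2 =
      2 * (harm (Suc n) / real (Suc n)) - (inverse (real (Suc n)))\<^sup>2" for n
    by (simp add: harm_Suc power2_eq_square divide_inverse algebra_simps del: of_nat_Suc)
  moreover have "(\<lambda>n. 2 * (harm (Suc n) / real (Suc n)) - (inverse (real (Suc n)))\<^sup>2)
      \<longlonglongrightarrow> 2 * 0 - 0\<^sup>2"
    by (intro tendsto_intros LIMSEQ_Suc[OF harm_over_n_tendsto_0] LIMSEQ_inverse_real_of_nat)
  ultimately show ?thesis by simp
qed

subsection \<open>The order of the row value\<close>

lemma expected_drop_harm_square_ge:
  assumes "0 \<le> p" "p \<le> 1"
  shows "1 - p \<le> expected_drop p (\<lambda>j. (harm j)\<^sup>2) m"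
proof -
  let ?h = "\<lambda>j. (harm j)\<^sup>2 :: real"
  have "?h m \<le> ?h (Suc m)"
    by (intro power_mono harm_mono harm_nonneg) simp
  then have "0 \<le> p * (?h (Suc m) - ?h m)"
    using assms by simp
  moreover have "1 - p \<le> (1 - p) * (?h (Suc m) - zipf_mean (Suc m) ?h)"
    using mult_left_mono[OF harm_square_minus_zipf_mean_bounds(1)[of "Suc m"], of "1 - p"] assms
    by simp
  ultimately show ?thesis
    unfolding expected_drop_def by (rule add_increasing)
qed

lemma expected_drop_harm_square_le:
  assumes "0 \<le> p" "p \<le> 1"
  shows "expected_drop p (\<lambda>j. (harm j)\<^sup>2) m \<le>
    (harm (Suc m))\<^sup>2 - (harm m)\<^sup>2 + (1 - p) * (pi\<^sup>2 / 3)"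
proof -
  let ?h = "\<lambda>j. (harm j)\<^sup>2 :: real"
  have "?h m \<le> ?h (Suc m)"
    by (intro power_mono harm_mono harm_nonneg) simp
  then have "p * (?h (Suc m) - ?h m) \<le> ?h (Suc m) - ?h m"
    using assms by (intro mult_left_le_one_le) auto
  moreover have "(1 - p) * (?h (Suc m) - zipf_mean (Suc m) ?h) \<le> (1 - p) * (pi\<^sup>2 / 3)"
    using assms harm_square_minus_zipf_mean_bounds(2)[of "Suc m"] by (intro mult_left_mono) auto
  ultimately show ?thesis
    unfolding expected_drop_def by linarith
qed

lemma row_value_le:
  assumes p: "0 \<le> p" "p < 1"
  shows "row_value p n \<le> (harm n)\<^sup>2 / (1 - p)"
proof -
  let ?g = "\<lambda>j. 1 / (1 - p) * (harm j)\<^sup>2 + 0"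
  have "row_value p n \<le> ?g n"
  proof (rule expected_drop_maximum_principle[where f = "row_value p" and g = ?g and M = 0])
    show "expected_drop p (row_value p) m \<le> expected_drop p ?g m" for m
      unfolding expected_drop_affine expected_drop_row_value
      using expected_drop_harm_square_ge[of p m] p by simp
  qed (use p in auto)
  then show ?thesis by simp
qed

lemma eventually_expected_drop_harm_square_le:
  assumes p: "0 \<le> p" "p < 1" and c: "0 < c" "c < 3 / pi\<^sup>2"
  shows "\<forall>\<^sub>F m in sequentially. c / (1 - p) * expected_drop p (\<lambda>j. (harm j)\<^sup>2) m \<le> 1"
proof -
  let ?a = "c / (1 - p)"
  have a: "?a > 0" "?a * (1 - p) = c"
    using p c by simp_all
  have "(\<lambda>m. ?a * ((harm (Suc m))\<^sup>2 - (harm m)\<^sup>2) + c * (pi\<^sup>2 / 3)) \<longlonglongrightarrow> ?a * 0 + c * (pi\<^sup>2 / 3)"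
    by (intro tendsto_intros harm_square_increment_tendsto_0)
  moreover have "?a * 0 + c * (pi\<^sup>2 / 3) < 1"
    using c by (simp add: field_simps)
  ultimately have "\<forall>\<^sub>F m in sequentially.
      ?a * ((harm (Suc m))\<^sup>2 - (harm m)\<^sup>2) + c * (pi\<^sup>2 / 3) < 1"
    by (rule order_tendstoD(2))
  then show ?thesis
  proof eventually_elim
    case (elim m)
    have "?a * expected_drop p (\<lambda>j. (harm j)\<^sup>2) m \<le>
        ?a * ((harm (Suc m))\<^sup>2 - (harm m)\<^sup>2 + (1 - p) * (pi\<^sup>2 / 3))"
      using a(1) p by (intro mult_left_mono expected_drop_harm_square_le) auto
    also have "\<dots> = ?a * ((harm (Suc m))\<^sup>2 - (harm m)\<^sup>2) + c * (pi\<^sup>2 / 3)"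
      unfolding distrib_left mult.assoc[symmetric] a(2) ..
    finally show ?case
      using elim by linarith
  qed
qed

lemma row_value_ge_minus_const:
  assumes p: "0 \<le> p" "p < 1" and c: "0 < c" "c < 3 / pi\<^sup>2"
  obtains d where "\<And>n. c * ((harm n)\<^sup>2 / (1 - p)) - d \<le> row_value p n"
proof -
  define a where "a = c / (1 - p)"
  have a: "a > 0"
    using p c by (simp add: a_def)
  obtain M where M: "a * expected_drop p (\<lambda>j. (harm j)\<^sup>2) m \<le> 1" if "M \<le> m" for m
    using eventually_expected_drop_harm_square_le[OF p c]
    unfolding eventually_sequentially a_def by blast
  define g where "g n = a * (harm n)\<^sup>2 + - (a * (harm M)\<^sup>2)" for n
  have "g n \<le> row_value p n" for n
  proof (rule expected_drop_maximum_principle[where p = p and M = M])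
    fix n assume "n \<le> M"
    then have "(harm n)\<^sup>2 \<le> (harm M :: real)\<^sup>2"
      by (intro power_mono harm_mono harm_nonneg)
    then have "g n \<le> 0"
      using a by (simp add: g_def)
    also have "0 \<le> row_value p n"
      using p by (intro row_value_nonneg) auto
    finally show "g n \<le> row_value p n" .
  next
    fix m assume "M \<le> m"
    then show "expected_drop p g m \<le> expected_drop p (row_value p) m"
      unfolding g_def expected_drop_affine expected_drop_row_value by (rule M)
  qed (use p in auto)
  then show thesis
    by (intro that[of "a * (harm M)\<^sup>2"]) (simp add: a_def g_def)
qed

lemma eventually_row_value_ge:
  assumes p: "0 \<le> p" "p < 1" and c: "0 < c" "c < 3 / pi\<^sup>2"
  shows "\<forall>\<^sub>F n in sequentially. c * ((harm n)\<^sup>2 / (1 - p)) \<le> row_value p n"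
proof -
  obtain c' where c': "c < c'" "c' < 3 / pi\<^sup>2"
    using dense[OF c(2)] by blast
  obtain d where d: "\<And>n. c' * ((harm n)\<^sup>2 / (1 - p)) - d \<le> row_value p n"
    using row_value_ge_minus_const[OF p _ c'(2)] c(1) c'(1) by (meson order.strict_trans)
  have "filterlim (\<lambda>n. (c' - c) / (1 - p) * (harm n)\<^sup>2) at_top sequentially"
    using p c' by (intro filterlim_tendsto_pos_mult_at_top[OF tendsto_const]
        filterlim_pow_at_top harm_at_top) auto
  then have "\<forall>\<^sub>F n in sequentially. d \<le> (c' - c) / (1 - p) * (harm n)\<^sup>2"
    unfolding filterlim_at_top by blast
  then show ?thesis
  proof eventually_elim
    case (elim n)
    have "(c' - c) / (1 - p) * (harm n)\<^sup>2 = c' * ((harm n)\<^sup>2 / (1 - p)) - c * ((harm n)\<^sup>2 / (1 - p))"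
      by (simp add: diff_divide_distrib left_diff_distrib)
    with elim d[of n] show ?case by linarith
  qed
qed

subsection \<open>The seating process\<close>

lemma expectation_pmf_cong:
  fixes f g :: "'a \<Rightarrow> 'b :: {banach, second_countable_topology}"
  assumes "\<And>x. x \<in> set_pmf M \<Longrightarrow> f x = g x"
  shows "measure_pmf.expectation M f = measure_pmf.expectation M g"
  using assms by (intro integral_cong_AE) (auto simp: AE_measure_pmf_iff)

lemma expectation_bind_pmf_finite:
  fixes f :: "'b \<Rightarrow> 'c :: {banach, second_countable_topology}"
  assumes "finite (set_pmf M)" "\<And>x. x \<in> set_pmf M \<Longrightarrow> finite (set_pmf (K x))"
  shows "measure_pmf.expectation (M \<bind> K) f =
    measure_pmf.expectation M (\<lambda>x. measure_pmf.expectation (K x) f)"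
  using assms by (simp add: pmf_expectation_bind[OF assms(1)] integral_measure_pmf[OF assms(1)])

lemma set_right_zipf_subset:
  assumes "n > 0"
  shows "set_pmf (right_zipf n) \<subseteq> {1..n}"
  using assms by (auto simp: set_pmf_eq pmf_right_zipf split: if_splits)

lemma expectation_right_zipf:
  assumes "n > 0"
  shows "measure_pmf.expectation (right_zipf n) (\<lambda>k. f (k - 1)) = zipf_mean n f"
proof -
  have "measure_pmf.expectation (right_zipf n) (\<lambda>k. f (k - 1)) =
      (\<Sum>k\<in>{1..n}. pmf (right_zipf n) k *\<^sub>R f (k - 1))"
    by (rule integral_measure_pmf) (use set_right_zipf_subset[OF assms] in auto)
  also have "\<dots> = (\<Sum>k\<in>{1..n}. f (k - 1) / real (n + 1 - k) / harm n)"
    using assms by (intro sum.cong) (simp_all add: pmf_right_zipf)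
  also have "\<dots> = (\<Sum>j<n. f j / real (n - j) / harm n)"
    by (rule sum.reindex_bij_witness[of _ Suc "\<lambda>k. k - 1"]) auto
  finally show ?thesis
    by (simp add: zipf_mean_def sum_divide_distrib)
qed

lemma expectation_status_pmf:
  assumes "0 \<le> p" "p \<le> 1"
  shows "measure_pmf.expectation (status_pmf p) h =
    p * h Courteous + (1 - p) * (h Selfish :: real)"
  using assms by (simp add: status_pmf_def mult.commute)

lemma finite_accessible: "finite (accessible n s)"
  by (simp add: accessible_def)

lemma accessible_courteous:
  assumes "a \<in> accessible n s"
  shows "accessible n (s(a \<mapsto> Courteous)) = accessible n s - {a}"
  using assms by (auto simp: accessible_def)

lemma accessible_selfish:
  assumes "a \<in> accessible n s"
  shows "accessible n (s(a \<mapsto> Selfish)) = {x \<in> accessible n s. x < a}"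
proof (rule set_eqI)
  fix x
  have a: "1 \<le> a" "s a = None"
    using assms by (simp_all add: accessible_def)
  have "(\<forall>j\<in>J. (s(a \<mapsto> Selfish)) j \<noteq> Some Selfish) \<longleftrightarrow> a \<notin> J \<and> (\<forall>j\<in>J. s j \<noteq> Some Selfish)" for J
    using a(2) by (metis fun_upd_apply option.distinct(1))
  then have "x \<in> accessible n (s(a \<mapsto> Selfish)) \<longleftrightarrow> x \<in> accessible n s \<and> x \<noteq> a \<and> a \<notin> {1..<x}"
    unfolding accessible_def mem_Collect_eq by (metis fun_upd_apply option.distinct(1))
  also have "x \<noteq> a \<and> a \<notin> {1..<x} \<longleftrightarrow> x < a"
    using a(1) by auto
  finally show "x \<in> accessible n (s(a \<mapsto> Selfish)) \<longleftrightarrow> x \<in> {x \<in> accessible n s. x < a}"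
    unfolding mem_Collect_eq .
qed

lemma finite_set_arrival: "finite (set_pmf (arrival n p s))"
proof (cases "accessible n s = {}")
  case False
  then have "finite (set_pmf (right_zipf (card (accessible n s))))"
    using finite_subset[OF set_right_zipf_subset] by (simp add: card_gt_0_iff finite_accessible)
  then show ?thesis
    using False by (simp add: arrival_def status_pmf_def)
qed (simp add: arrival_def)

lemma finite_set_after_arrivals: "finite (set_pmf (after_arrivals n p t))"
  by (induction t) (simp_all add: finite_set_arrival)

lemma nth_sorted_list_of_set_in:
  assumes "finite A" "i < card A"
  shows "sorted_list_of_set A ! i \<in> A"
  using assms nth_mem[of i "sorted_list_of_set A"] by simp

lemma card_less_nth_sorted_list_of_set:
  fixes A :: "'a :: linorder set"
  assumes "finite A" "i < card A"
  shows "card {x \<in> A. x < sorted_list_of_set A ! i} = i"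
proof -
  let ?xs = "sorted_list_of_set A"
  have split: "?xs = take i ?xs @ ?xs ! i # drop (Suc i) ?xs"
    using assms by (intro id_take_nth_drop) simp
  have sorted: "sorted_wrt (<) (take i ?xs @ ?xs ! i # drop (Suc i) ?xs)"
    using strict_sorted_list_of_set[of A] by (simp flip: split)
  have "{x \<in> A. x < ?xs ! i} =
      {x \<in> set (take i ?xs @ ?xs ! i # drop (Suc i) ?xs). x < ?xs ! i}"
    using assms(1) by (simp flip: split)
  also have "\<dots> = set (take i ?xs)"
    using sorted by (auto simp: sorted_wrt_append dest: order.asym)
  finally show ?thesis
    using assms by (simp add: distinct_card)
qed

definition potential :: "nat \<Rightarrow> real \<Rightarrow> config \<Rightarrow> real" where
  "potential n p s = real (card (dom s)) + row_value p (card (accessible n s))"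

lemma expectation_potential_occupy:
  assumes p: "0 \<le> p" "p \<le> 1" and dom: "finite (dom s)" and a: "a \<in> accessible n s"
  shows "measure_pmf.expectation (status_pmf p) (\<lambda>c. potential n p (s(a \<mapsto> c))) =
    real (card (dom s)) + 1 + p * row_value p (card (accessible n s) - 1) +
      (1 - p) * row_value p (card {x \<in> accessible n s. x < a})"
proof -
  have "a \<notin> dom s"
    using a by (simp add: accessible_def domIff)
  then have "card (dom (s(a \<mapsto> c))) = Suc (card (dom s))" for c
    using dom by simp
  then show ?thesis
    by (simp add: expectation_status_pmf[OF p] potential_def accessible_courteous[OF a]
        accessible_selfish[OF a] a finite_accessible algebra_simps)
qed

lemma expectation_potential_arrival:
  assumes p: "0 \<le> p" "p \<le> 1" and dom: "finite (dom s)"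
  shows "measure_pmf.expectation (arrival n p s) (potential n p) = potential n p s"
proof (cases "card (accessible n s)")
  case 0
  then show ?thesis by (simp add: finite_accessible arrival_def)
next
  case (Suc m)
  let ?A = "accessible n s"
  let ?v = "\<lambda>j. (1 - p) * row_value p j + (real (card (dom s)) + 1 + p * row_value p m)"
  define seat where "seat k = sorted_list_of_set ?A ! (k - 1)" for k
  have "arrival n p s =
      right_zipf (Suc m) \<bind> (\<lambda>k. map_pmf (\<lambda>c. s(seat k \<mapsto> c)) (status_pmf p))"
    using Suc by (auto simp: arrival_def seat_def map_pmf_def)
  then have "measure_pmf.expectation (arrival n p s) (potential n p) =
      measure_pmf.expectation (right_zipf (Suc m))
        (\<lambda>k. measure_pmf.expectation (status_pmf p) (\<lambda>c. potential n p (s(seat k \<mapsto> c))))"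
    by (simp add: expectation_bind_pmf_finite finite_subset[OF set_right_zipf_subset] status_pmf_def)
  also have "\<dots> = measure_pmf.expectation (right_zipf (Suc m)) (\<lambda>k. ?v (k - 1))"
  proof (rule expectation_pmf_cong)
    fix k assume "k \<in> set_pmf (right_zipf (Suc m))"
    then have "k \<in> {1..Suc m}"
      using set_right_zipf_subset[of "Suc m"] by blast
    then have k: "k - 1 < card ?A"
      using Suc by auto
    then have "seat k \<in> ?A"
      unfolding seat_def by (rule nth_sorted_list_of_set_in[OF finite_accessible])
    moreover have "card {x \<in> ?A. x < seat k} = k - 1"
      unfolding seat_def by (rule card_less_nth_sorted_list_of_set[OF finite_accessible k])
    ultimately show "measure_pmf.expectation (status_pmf p) (\<lambda>c. potential n p (s(seat k \<mapsto> c))) =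
        ?v (k - 1)"
      by (simp add: expectation_potential_occupy[OF p dom] Suc)
  qed
  also have "\<dots> = zipf_mean (Suc m) ?v"
    by (rule expectation_right_zipf) simp
  also have "\<dots> = potential n p s"
    by (simp add: zipf_mean_affine potential_def Suc)
  finally show ?thesis .
qed

lemma expectation_potential_after_arrivals:
  assumes p: "0 \<le> p" "p \<le> 1"
  shows "measure_pmf.expectation (after_arrivals n p t) (potential n p) = row_value p n"
proof (induction t)
  case 0
  have "accessible n Map.empty = {1..n}" by (auto simp: accessible_def)
  then show ?case by (simp add: potential_def)
next
  case (Suc t)
  have "measure_pmf.expectation (after_arrivals n p (Suc t)) (potential n p) =
      measure_pmf.expectation (after_arrivals n p t)
        (\<lambda>s. measure_pmf.expectation (arrival n p s) (potential n p))"
    by (simp add: expectation_bind_pmf_finite finite_set_after_arrivals finite_set_arrival)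
  also have "\<dots> = measure_pmf.expectation (after_arrivals n p t) (potential n p)"
  proof (rule expectation_pmf_cong)
    fix s assume "s \<in> set_pmf (after_arrivals n p t)"
    then have "dom s \<subseteq> {1..n}"
      using after_arrivals_progress by blast
    then have "finite (dom s)"
      by (rule finite_subset) simp
    then show "measure_pmf.expectation (arrival n p s) (potential n p) = potential n p s"
      by (rule expectation_potential_arrival[OF p])
  qed
  finally show ?case using Suc.IH by simp
qed

lemma expected_occupied_eq_row_value:
  assumes "0 \<le> p" "p \<le> 1"
  shows "expected_occupied n p = row_value p n"
proof -
  have "expected_occupied n p = measure_pmf.expectation (final_config n p) (potential n p)"
    unfolding expected_occupied_def
    by (intro expectation_pmf_cong) (simp add: potential_def final_config_no_accessible)
  then show ?thesis
    using expectation_potential_after_arrivals[OF assms] by (simp add: final_config_def)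
qed

lemma expected_occupied_nonneg: "0 \<le> expected_occupied n p"
  unfolding expected_occupied_def by (rule Bochner_Integration.integral_nonneg) simp

lemma expected_occupied_le:
  assumes "0 \<le> p" "p < 1"
  shows "expected_occupied n p \<le> (harm n)\<^sup>2 / (1 - p)"
  using row_value_le[OF assms] assms by (simp add: expected_occupied_eq_row_value)

lemma eventually_expected_occupied_ge:
  assumes p: "0 \<le> p" "p < 1" and c: "0 < c" "c < 3 / pi\<^sup>2" and b: "b \<le> 1"
  shows "\<forall>\<^sub>F n in sequentially. c * ((harm n)\<^sup>2 / (1 - b * p)) \<le> expected_occupied n p"
  using eventually_row_value_ge[OF p c]
proof eventually_elim
  case (elim n)
  have "b * p \<le> p"
    using mult_right_mono[OF b p(1)] by simp
  then have "c * ((harm n)\<^sup>2 / (1 - b * p)) \<le> c * ((harm n)\<^sup>2 / (1 - p))"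
    using p c by (intro mult_left_mono divide_left_mono mult_pos_pos) auto
  with elim show ?case
    using p by (simp add: expected_occupied_eq_row_value)
qed

theorem theorem10:
  "(\<forall>p::real. 0 \<le> p \<and> p < 1 \<longrightarrow>
      (\<lambda>n. expected_occupied n p) \<in> \<Omega>(\<lambda>n. (harm n)\<^sup>2 / (1 - 0.944 * p)) \<and>
      (\<lambda>n. expected_occupied n p) \<in> O(\<lambda>n. (harm n)\<^sup>2 / (1 - p))) \<and>
   (\<exists>c>0. \<exists>C>0. \<forall>p::real. 0 \<le> p \<and> p < 1 \<longrightarrow>
      (\<forall>\<^sub>F n in sequentially.
         c * ((harm n)\<^sup>2 / (1 - 0.944 * p)) \<le> expected_occupied n p \<and>
         expected_occupied n p \<le> C * ((harm n)\<^sup>2 / (1 - p))))"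
proof -
  have "pi\<^sup>2 < 4\<^sup>2"
    by (intro power_strict_mono pi_less_4) simp_all
  then have one_sixth: "0 < (1 / 6 :: real)" "1 / 6 < 3 / pi\<^sup>2"
    by (simp_all add: field_simps)
  have bounds: "\<forall>\<^sub>F n in sequentially.
      1 / 6 * ((harm n)\<^sup>2 / (1 - 0.944 * p)) \<le> expected_occupied n p \<and>
      expected_occupied n p \<le> 1 * ((harm n)\<^sup>2 / (1 - p))" if p: "0 \<le> p" "p < 1" for p
    using eventually_expected_occupied_ge[OF p one_sixth, of "0.944"] expected_occupied_le[OF p]
    by (auto elim: eventually_mono)
  moreover have "(\<lambda>n. expected_occupied n p) \<in> \<Omega>(\<lambda>n. (harm n)\<^sup>2 / (1 - 0.944 * p))"
    if p: "0 \<le> p" "p < 1" for p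
    by (rule landau_omega.bigI[OF one_sixth(1) eventually_mono[OF bounds[OF p]]])
      (use p expected_occupied_nonneg in simp)
  moreover have "(\<lambda>n. expected_occupied n p) \<in> O(\<lambda>n. (harm n)\<^sup>2 / (1 - p))"
    if p: "0 \<le> p" "p < 1" for p
    by (rule bigoI[where c = 1, OF eventually_mono[OF bounds[OF p]]])
      (use p expected_occupied_nonneg in simp)
  ultimately show ?thesis
    by (intro conjI exI[of _ "1 / 6"] exI[of _ 1]) auto
qed

end
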